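(* Let $\mathsf{H}$ be a quaternionic Hilbert space and let $T:D(T)\to\mathsf{H}$ be an operator. Then the spherical point spectrum $\sigma_{pS}(T)$ coincides with the set of all eigenvalues of $T$.
   Context: $\mathbb{H}$ denotes the quaternions, with conjugation $q\mapsto\overline q$ and norm $|q|=\sqrt{q\overline q}$. A quaternionic Hilbert space $\mathsf{H}$ is a nonzero right $\mathbb{H}$-module with a scalar product $\langle\cdot|\cdot\rangle$ valued in $\mathbb{H}$, right $\mathbb{H}$-linear in the second argument, with $\langle u|v\rangle=\overline{\langle v|u\rangle}$, $\langle u|u\rangle\ge0$ (zero only for $u=0$), complete for $\|u\|=\sqrt{\langle u|u\rangle}$. An operator is a right $\mathbb{H}$-linear map $T:D(T)\to\mathsf{H}$ defined on a (not necessarily closed or dense) right $\mathbb{H}$-linear subspace $D(T)\subset\mathsf{H}$. For $q\in\mathbb{H}$, $\Delta_q(T):D(T^2)\to\mathsf{H}$ is $\Delta_q(T):=T^2-T(q+\overline q)+\mathrm{I}|q|^2$, where $(Tr)(u)=T(u)r$ for $r\in\mathbb{R}$ and $D(T^2)=\{u\in D(T):Tu\in D(T)\}$; $\sigma_{pS}(T):=\{q\in\mathbb{H}:\mathrm{Ker}(\Delta_q(T))\ne\{0\}\}$. A quaternion $q$ is an eigenvalue of $T$ if $Tu=uq$ for some $u\in D(T)\setminus\{0\}$. *)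

theory Defs
  imports "HOL-Analysis.Inner_Product"
begin

section \<open>Quaternions\<close>

text \<open>\<open>Quat a b c d\<close> stands for \<open>a + b i + c j + d k\<close>, with
  \<open>i j = k\<close>, \<open>j k = i\<close>, \<open>k i = j\<close> and \<open>i\<^sup>2 = j\<^sup>2 = k\<^sup>2 = -1\<close>.\<close>

datatype quat = Quat (qRe: real) (qIm1: real) (qIm2: real) (qIm3: real)

lemma quat_eq_iff:
  "p = q \<longleftrightarrow> qRe p = qRe q \<and> qIm1 p = qIm1 q \<and> qIm2 p = qIm2 q \<and> qIm3 p = qIm3 q"
  by (cases p; cases q) simp

definition qcnj :: "quat \<Rightarrow> quat" where
  "qcnj q = Quat (qRe q) (- qIm1 q) (- qIm2 q) (- qIm3 q)"

lemma qcnj_sel [simp]: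
  "qRe (qcnj q) = qRe q" "qIm1 (qcnj q) = - qIm1 q"
  "qIm2 (qcnj q) = - qIm2 q" "qIm3 (qcnj q) = - qIm3 q"
  by (simp_all add: qcnj_def)

instantiation quat :: real_vector
begin

definition "0 = Quat 0 0 0 0"

definition
  "p + q = Quat (qRe p + qRe q) (qIm1 p + qIm1 q) (qIm2 p + qIm2 q) (qIm3 p + qIm3 q)"

definition "- q = Quat (- qRe q) (- qIm1 q) (- qIm2 q) (- qIm3 q)"

definition "p - q = p + (- q)" for p q :: quat

definition "r *\<^sub>R q = Quat (r * qRe q) (r * qIm1 q) (r * qIm2 q) (r * qIm3 q)"

instance
  by standard
    (simp_all add: quat_eq_iff zero_quat_def plus_quat_def uminus_quat_def minus_quat_def
      scaleR_quat_def algebra_simps)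

end

lemma quat_vector_sel [simp]:
  "qRe 0 = 0" "qIm1 0 = 0" "qIm2 0 = 0" "qIm3 0 = 0"
  "qRe (p + q) = qRe p + qRe q" "qIm1 (p + q) = qIm1 p + qIm1 q"
  "qIm2 (p + q) = qIm2 p + qIm2 q" "qIm3 (p + q) = qIm3 p + qIm3 q"
  "qRe (- q) = - qRe q" "qIm1 (- q) = - qIm1 q"
  "qIm2 (- q) = - qIm2 q" "qIm3 (- q) = - qIm3 q"
  "qRe (p - q) = qRe p - qRe q" "qIm1 (p - q) = qIm1 p - qIm1 q"
  "qIm2 (p - q) = qIm2 p - qIm2 q" "qIm3 (p - q) = qIm3 p - qIm3 q"
  "qRe (r *\<^sub>R q) = r * qRe q" "qIm1 (r *\<^sub>R q) = r * qIm1 q"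
  "qIm2 (r *\<^sub>R q) = r * qIm2 q" "qIm3 (r *\<^sub>R q) = r * qIm3 q"
  by (simp_all add: zero_quat_def plus_quat_def uminus_quat_def minus_quat_def scaleR_quat_def)

instantiation quat :: real_algebra_1
begin

definition "1 = Quat 1 0 0 0"

definition
  "p * q = Quat
    (qRe p * qRe q - qIm1 p * qIm1 q - qIm2 p * qIm2 q - qIm3 p * qIm3 q)
    (qRe p * qIm1 q + qIm1 p * qRe q + qIm2 p * qIm3 q - qIm3 p * qIm2 q)
    (qRe p * qIm2 q - qIm1 p * qIm3 q + qIm2 p * qRe q + qIm3 p * qIm1 q)
    (qRe p * qIm3 q + qIm1 p * qIm2 q - qIm2 p * qIm1 q + qIm3 p * qRe q)"

instance
  by standard (simp_all add: quat_eq_iff one_quat_def times_quat_def algebra_simps)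

end

lemma quat_ring_sel [simp]:
  "qRe 1 = 1" "qIm1 1 = 0" "qIm2 1 = 0" "qIm3 1 = 0"
  "qRe (p * q) = qRe p * qRe q - qIm1 p * qIm1 q - qIm2 p * qIm2 q - qIm3 p * qIm3 q"
  "qIm1 (p * q) = qRe p * qIm1 q + qIm1 p * qRe q + qIm2 p * qIm3 q - qIm3 p * qIm2 q"
  "qIm2 (p * q) = qRe p * qIm2 q - qIm1 p * qIm3 q + qIm2 p * qRe q + qIm3 p * qIm1 q"
  "qIm3 (p * q) = qRe p * qIm3 q + qIm1 p * qIm2 q - qIm2 p * qIm1 q + qIm3 p * qRe q"
  by (simp_all add: one_quat_def times_quat_def)

lemma quat_of_real_sel [simp]:
  "qRe (of_real r) = r" "qIm1 (of_real r) = 0" "qIm2 (of_real r) = 0" "qIm3 (of_real r) = 0"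
  by (simp_all add: of_real_def)

text \<open>\<open>q * qcnj q\<close> is a nonnegative real, so its real part loses nothing
  (see \<open>quat_mult_qcnj\<close> below).\<close>

instantiation quat :: real_inner
begin

definition "inner p q = qRe (p * qcnj q)"
definition "norm q = sqrt (qRe (q * qcnj q))"
definition "sgn q = q /\<^sub>R norm q" for q :: quat
definition "dist p q = norm (p - q)" for p q :: quat
definition [code del]:
  "(uniformity :: (quat \<times> quat) filter) = (INF e\<in>{0<..}. principal {(x, y). dist x y < e})"
definition [code del]:
  "open (U :: quat set) \<longleftrightarrow> (\<forall>x\<in>U. eventually (\<lambda>(x', y). x' = x \<longrightarrow> y \<in> U) uniformity)"

instance
proof
  fix x y z :: quat and r :: real
  show "inner x y = inner y x"
    by (simp add: inner_quat_def)
  show "inner (x + y) z = inner x z + inner y z"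
    by (simp add: inner_quat_def algebra_simps)
  show "inner (r *\<^sub>R x) y = r * inner x y"
    by (simp add: inner_quat_def algebra_simps)
  show "0 \<le> inner x x"
    by (simp add: inner_quat_def)
  have "inner x x = (qRe x)\<^sup>2 + (qIm1 x)\<^sup>2 + (qIm2 x)\<^sup>2 + (qIm3 x)\<^sup>2"
    by (simp add: inner_quat_def power2_eq_square)
  then show "inner x x = 0 \<longleftrightarrow> x = 0"
    by (simp add: quat_eq_iff add_nonneg_eq_0_iff)
  show "norm x = sqrt (inner x x)"
    by (simp add: norm_quat_def inner_quat_def)
qed (simp_all add: dist_quat_def sgn_quat_def uniformity_quat_def open_quat_def)

end

lemma quat_norm_squared: "(norm q)\<^sup>2 = (qRe q)\<^sup>2 + (qIm1 q)\<^sup>2 + (qIm2 q)\<^sup>2 + (qIm3 q)\<^sup>2"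
  unfolding norm_quat_def by (simp add: power2_eq_square)

lemma quat_mult_qcnj: "q * qcnj q = of_real ((norm q)\<^sup>2)"
  unfolding quat_norm_squared by (simp add: quat_eq_iff power2_eq_square)

lemma quat_qcnj_mult: "qcnj q * q = of_real ((norm q)\<^sup>2)"
  unfolding quat_norm_squared by (simp add: quat_eq_iff power2_eq_square)

instantiation quat :: real_normed_div_algebra
begin

definition "inverse q = qcnj q /\<^sub>R (norm q)\<^sup>2"
definition "p div q = p * inverse q" for p q :: quat

instance
proof
  fix x y :: quat
  show "x \<noteq> 0 \<Longrightarrow> inverse x * x = 1"
    by (simp add: inverse_quat_def quat_qcnj_mult of_real_def)
  show "x \<noteq> 0 \<Longrightarrow> x * inverse x = 1"
    by (simp add: inverse_quat_def quat_mult_qcnj of_real_def)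
  show "x div y = x * inverse y"
    by (simp add: divide_quat_def)
  show "inverse 0 = (0 :: quat)"
    by (simp add: inverse_quat_def quat_eq_iff)
  have "(norm (x * y))\<^sup>2 = (norm x * norm y)\<^sup>2"
    unfolding power_mult_distrib quat_norm_squared quat_ring_sel by algebra
  then show "norm (x * y) = norm x * norm y"
    by (metis mult_nonneg_nonneg norm_ge_zero power2_eq_imp_eq)
qed

end


section \<open>Quaternionic Hilbert spaces and operators\<close>

text \<open>The distribution's modules are over commutative rings; here \<open>scale u q\<close> is the right
  multiplication \<open>u q\<close>.\<close>

locale right_quat_module =
  fixes scale :: "'a::ab_group_add \<Rightarrow> quat \<Rightarrow> 'a"
  assumes scale_add_left: "scale (u + v) q = scale u q + scale v q"
    and scale_add_right: "scale u (p + q) = scale u p + scale u q"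
    and scale_scale: "scale (scale u p) q = scale u (p * q)"
    and scale_one: "scale u 1 = u"

definition ip_norm :: "('a \<Rightarrow> 'a \<Rightarrow> quat) \<Rightarrow> 'a \<Rightarrow> real" where
  "ip_norm ip u = sqrt (qRe (ip u u))"

locale quat_hilbert_space = right_quat_module scale
  for scale :: "'a::ab_group_add \<Rightarrow> quat \<Rightarrow> 'a" +
  fixes ip :: "'a \<Rightarrow> 'a \<Rightarrow> quat"
  assumes nonzero: "\<exists>u::'a. u \<noteq> 0"
    and ip_add_right: "ip u (v + w) = ip u v + ip u w"
    and ip_scale_right: "ip u (scale v q) = ip u v * q"
    and ip_cnj: "ip u v = qcnj (ip v u)"
    and ip_self_real: "ip u u \<in> \<real>"
    and ip_self_nonneg: "0 \<le> qRe (ip u u)"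
    and ip_self_eq_0: "ip u u = 0 \<Longrightarrow> u = 0"
    and complete:
      "\<lbrakk>\<And>e. e > 0 \<Longrightarrow> \<exists>N. \<forall>m\<ge>N. \<forall>n\<ge>N. ip_norm ip (X m - X n) < e\<rbrakk>
        \<Longrightarrow> \<exists>L. (\<lambda>n. ip_norm ip (X n - L)) \<longlonglongrightarrow> 0"

text \<open>An operator is a pair of its domain \<open>D\<close> and a function \<open>T\<close>, of which only the values
  on \<open>D\<close> matter.\<close>

locale quat_operator =
  fixes scale :: "'a::ab_group_add \<Rightarrow> quat \<Rightarrow> 'a" and D :: "'a set" and T :: "'a \<Rightarrow> 'a"
  assumes dom_zero: "0 \<in> D"
    and dom_add: "\<lbrakk>u \<in> D; v \<in> D\<rbrakk> \<Longrightarrow> u + v \<in> D"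
    and dom_scale: "u \<in> D \<Longrightarrow> scale u q \<in> D"
    and op_add: "\<lbrakk>u \<in> D; v \<in> D\<rbrakk> \<Longrightarrow> T (u + v) = T u + T v"
    and op_scale: "u \<in> D \<Longrightarrow> T (scale u q) = scale (T u) q"

definition dom_sq :: "'a set \<Rightarrow> ('a \<Rightarrow> 'a) \<Rightarrow> 'a set" where
  "dom_sq D T = {u \<in> D. T u \<in> D}"

text \<open>To be used on \<open>dom_sq D T\<close> only. Note that \<open>q + qcnj q\<close> is real.\<close>

definition Delta ::
  "('a::ab_group_add \<Rightarrow> quat \<Rightarrow> 'a) \<Rightarrow> ('a \<Rightarrow> 'a) \<Rightarrow> quat \<Rightarrow> 'a \<Rightarrow> 'a" where
  "Delta scale T q u = T (T u) - scale (T u) (q + qcnj q) + scale u (of_real ((norm q)\<^sup>2))"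

definition ker_Delta ::
  "('a::ab_group_add \<Rightarrow> quat \<Rightarrow> 'a) \<Rightarrow> 'a set \<Rightarrow> ('a \<Rightarrow> 'a) \<Rightarrow> quat \<Rightarrow> 'a set" where
  "ker_Delta scale D T q = {u \<in> dom_sq D T. Delta scale T q u = 0}"

definition spherical_point_spectrum ::
  "('a::ab_group_add \<Rightarrow> quat \<Rightarrow> 'a) \<Rightarrow> 'a set \<Rightarrow> ('a \<Rightarrow> 'a) \<Rightarrow> quat set" where
  "spherical_point_spectrum scale D T = {q. ker_Delta scale D T q \<noteq> {0}}"

definition is_eigenvalue ::
  "('a::ab_group_add \<Rightarrow> quat \<Rightarrow> 'a) \<Rightarrow> 'a set \<Rightarrow> ('a \<Rightarrow> 'a) \<Rightarrow> quat \<Rightarrow> bool" where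
  "is_eigenvalue scale D T q \<longleftrightarrow> (\<exists>u \<in> D - {0}. T u = scale u q)"

end

theory Submission
  imports Defs
begin

text \<open>If \<open>\<Delta>\<^sub>q u = 0\<close> with \<open>u \<noteq> 0\<close>, put \<open>v = Tu - u q\<^sup>*\<close>, where \<open>q\<^sup>*\<close> is the conjugate of \<open>q\<close>.
  Since \<open>q + q\<^sup>*\<close> and \<open>q\<^sup>* q\<close> are real, \<open>Tv - v q = \<Delta>\<^sub>q u = 0\<close>, so \<open>v\<close> is an eigenvector for \<open>q\<close>
  unless \<open>v = 0\<close>. In that case \<open>Tu = u q\<^sup>*\<close>, and choosing \<open>s \<noteq> 0\<close> with \<open>q\<^sup>* s = s q\<close> makes \<open>u s\<close>
  an eigenvector for \<open>q\<close>.\<close>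

text \<open>A nonzero imaginary \<open>s\<close> orthogonal to the imaginary part of
  \<open>q\<close> anticommutes with it and commutes with the real part, so moving \<open>s\<close>
  across \<open>q\<close> conjugates \<open>q\<close>.\<close>

lemma qcnj_similar: "\<exists>s. s \<noteq> 0 \<and> qcnj q * s = s * q"
proof (cases "qIm1 q = 0 \<and> qIm2 q = 0")
  case True
  \<comment> \<open>Here the imaginary part is a multiple of k, to which i is orthogonal; the
    witness of the other case would vanish.\<close>
  then have "qcnj q * Quat 0 1 0 0 = Quat 0 1 0 0 * q"
    by (simp add: quat_eq_iff)
  moreover have "Quat 0 1 0 0 \<noteq> 0"
    by (simp add: quat_eq_iff)
  ultimately show ?thesis by blast
next
  case False
  \<comment> \<open>a purely imaginary quaternion orthogonal to the imaginary part of \<open>q\<close>\<close>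
  let ?s = "Quat 0 (- qIm2 q) (qIm1 q) 0"
  have "qcnj q * ?s = ?s * q"
    by (simp add: quat_eq_iff)
  moreover have "?s \<noteq> 0"
    using False by (auto simp: quat_eq_iff)
  ultimately show ?thesis by blast
qed

context right_quat_module
begin

lemma scale_zero_left [simp]: "scale 0 q = 0"
  using scale_add_left[of 0 0 q] by simp

lemma scale_zero_right [simp]: "scale u 0 = 0"
  using scale_add_right[of u 0 0] by simp

lemma scale_minus_left: "scale (- u) q = - scale u q"
  using scale_add_left[of u "- u" q] by (simp add: eq_neg_iff_add_eq_0 add.commute)

lemma scale_minus_right: "scale u (- q) = - scale u q"
  using scale_add_right[of u q "- q"] by (simp add: eq_neg_iff_add_eq_0 add.commute)

lemma scale_diff_left: "scale (u - v) q = scale u q - scale v q"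
  using scale_add_left[of u "- v" q] by (simp add: scale_minus_left)

lemma scale_eq_0_iff: "scale u q = 0 \<longleftrightarrow> u = 0 \<or> q = 0"
proof
  assume "scale u q = 0"
  then have "scale u (q * inverse q) = 0"
    by (simp flip: scale_scale)
  then show "u = 0 \<or> q = 0"
    by (cases "q = 0") (simp_all add: scale_one)
qed auto

lemma Delta_zero_eigenvector:
  assumes "quat_operator scale D T" and "u \<in> D" and "T u = scale u q"
  shows "u \<in> ker_Delta scale D T q"
proof -
  interpret quat_operator scale D T by fact
  have "T u \<in> D" using assms dom_scale by simp
  moreover have "T (T u) = scale u (q * q)"
    using assms by (simp add: op_scale scale_scale)
  ultimately show ?thesis
    using assms(2,3)
    by (simp add: ker_Delta_def dom_sq_def Delta_def scale_scale scale_add_right distrib_left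
        quat_mult_qcnj)
qed

lemma eigenvector_of_Delta_zero:
  assumes "quat_operator scale D T" and "u \<in> ker_Delta scale D T q" and "u \<noteq> 0"
  shows "is_eigenvalue scale D T q"
proof -
  interpret quat_operator scale D T by fact
  have u: "u \<in> D" "T u \<in> D" and Delta: "Delta scale T q u = 0"
    using assms(2) by (simp_all add: ker_Delta_def dom_sq_def)
  define v where "v = T u - scale u (qcnj q)"
  \<comment> \<open>As a sum with the sign moved into the scalar, \<open>v\<close> falls under the
    closure and linearity axioms of \<open>quat_operator\<close>.\<close>
  have v_alt: "v = T u + scale u (- qcnj q)"
    by (simp add: v_def scale_minus_right)
  have vD: "v \<in> D"
    unfolding v_alt by (intro dom_add dom_scale u)
  have "T v = T (T u) - scale (T u) (qcnj q)"
    unfolding v_alt using u by (simp add: op_add op_scale dom_scale) (simp add: scale_minus_right)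
  moreover have "scale v q = scale (T u) q - scale u (of_real ((norm q)\<^sup>2))"
    by (simp only: v_def scale_diff_left scale_scale quat_qcnj_mult)
  moreover have "T (T u) = scale (T u) q + scale (T u) (qcnj q) - scale u (of_real ((norm q)\<^sup>2))"
    using Delta by (simp add: Delta_def scale_add_right algebra_simps eq_neg_iff_add_eq_0)
  ultimately have Tv: "T v = scale v q"
    by simp
  show ?thesis
  proof (cases "v = 0")
    case True
    then have Tu: "T u = scale u (qcnj q)"
      by (simp add: v_def)
    obtain s where s: "s \<noteq> 0" "qcnj q * s = s * q"
      using qcnj_similar by blast
    have "T (scale u s) = scale (scale u s) q"
      using u s by (simp add: op_scale Tu scale_scale)
    moreover have "scale u s \<in> D - {0}"
      using u s assms(3) by (simp add: dom_scale scale_eq_0_iff)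
    ultimately show ?thesis
      unfolding is_eigenvalue_def by blast
  next
    case False
    with vD Tv show ?thesis
      unfolding is_eigenvalue_def by blast
  qed
qed

end

theorem proposition4p5:
  fixes scale :: "'a::ab_group_add \<Rightarrow> quat \<Rightarrow> 'a"
    and ip :: "'a \<Rightarrow> 'a \<Rightarrow> quat"
    and D :: "'a set"
    and T :: "'a \<Rightarrow> 'a"
  assumes "quat_hilbert_space scale ip"
    and "quat_operator scale D T"
  shows "spherical_point_spectrum scale D T = {q. is_eigenvalue scale D T q}"
proof -
  interpret quat_hilbert_space scale ip by fact
  interpret quat_operator scale D T by fact
  have "T 0 = 0"
    using op_add[OF dom_zero dom_zero] by simp
  \<comment> \<open>The kernel is never empty, so differing from \<open>{0}\<close> means having a
    nonzero element.\<close>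
  then have zero: "0 \<in> ker_Delta scale D T q" for q
    using Delta_zero_eigenvector[OF assms(2) dom_zero] by simp
  have "ker_Delta scale D T q \<noteq> {0} \<longleftrightarrow> is_eigenvalue scale D T q" for q
  proof
    assume "ker_Delta scale D T q \<noteq> {0}"
    with zero obtain u where "u \<in> ker_Delta scale D T q" "u \<noteq> 0"
      by blast
    then show "is_eigenvalue scale D T q"
      by (rule eigenvector_of_Delta_zero[OF assms(2)])
  next
    assume "is_eigenvalue scale D T q"
    then obtain u where "u \<in> D" "u \<noteq> 0" "T u = scale u q"
      unfolding is_eigenvalue_def by blast
    then show "ker_Delta scale D T q \<noteq> {0}"
      using Delta_zero_eigenvector[OF assms(2)] by blast
  qed
  then show ?thesis
    by (simp add: spherical_point_spectrum_def)
qed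

end
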